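(* For $n\in\mathbb{N}$, $m\in\{0,1,\ldots,n\}$ and $x\in[0,1]$ let $K(x;m,n)$ be the triangular density kernel defined by: for $m=0$, $K(x;0,n)=2n-2n^2x$ if $x\in(0,\frac1n)$ and $0$ otherwise; for $m=1,\ldots,n-1$, $K(x;m,n)=n^2\big(x-\frac mn\big)+n$ if $x\in\big(\frac{m-1}n,\frac mn\big)$, $K(x;m,n)=-n^2\big(x-\frac mn\big)+n$ if $x\in\big(\frac mn,\frac{m+1}n\big)$, and $0$ otherwise; for $m=n$, $K(x;n,n)=2n+2n^2(x-1)$ if $x\in\big(1-\frac1n,1\big)$ and $0$ otherwise. Let $\Theta=\{(m,n):n\in\mathbb{N},\ m\in\{0,\ldots,n\}\}$, let $\Pi$ be a prior on $\mathscr{M}(\Theta)$, and let $\Pi^*$ be the kernel mixture prior induced by $\Pi$ via $P\mapsto f_P$, $f_P(x)=\int_\Theta K(x;m,n)\,dP(m,n)$. If $f_0$ is a continuous density on $[0,1]$ and the weak support of $\Pi$ contains $\mathscr{M}(\Theta)$, then $f_0\in\mathrm{KL}(\Pi^* )$.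
   Context: $\mathbb{N}$ is the set of positive integers; $\mathscr{M}(S)$ is the set of probability measures on $S$ ($\Theta$ carries the discrete topology); a prior is a probability measure on the indicated space; the weak support of a prior on $\mathscr{M}(S)$ is its support in the topology of weak convergence. $f_0\in\mathrm{KL}(\Pi^* )$ means $\Pi^*(\{f:\int f_0\log(f_0/f)<\epsilon\})>0$ for every $\epsilon>0$. *)

theory Defs
  imports "HOL-Probability.Probability"
begin

definition borel_of :: "'a topology \<Rightarrow> 'a measure" where
  "borel_of X = sigma (topspace X) {U. openin X U}"

definition prob_measures :: "'a topology \<Rightarrow> 'a measure set" where
  "prob_measures X = {P. prob_space P \<and> sets P = sets (borel_of X)}"

text \<open>The coarsest topology on the probability measures on \<open>X\<close> making \<open>P \<mapsto> \<integral>h dP\<close>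
  continuous for every bounded continuous \<open>h\<close>.\<close>

definition weak_topology :: "'a topology \<Rightarrow> 'a measure topology" where
  "weak_topology X = topology_generated_by
     {{P \<in> prob_measures X. (\<integral>t. h t \<partial>P) \<in> V} | (h :: 'a \<Rightarrow> real) V.
        continuous_map X euclideanreal h \<and> bounded (h ` topspace X) \<and> open V}"

definition prior_on :: "'a topology \<Rightarrow> 'a measure \<Rightarrow> bool" where
  "prior_on X M \<longleftrightarrow> prob_space M \<and> sets M = sets (borel_of X)"

definition support_of :: "'a topology \<Rightarrow> 'a measure \<Rightarrow> 'a set" where
  "support_of X M = {x \<in> topspace X. \<forall>U. openin X U \<and> x \<in> U \<longrightarrow> emeasure M U > 0}"

abbreviation unit_lborel :: "real measure" where
  "unit_lborel \<equiv> restrict_space lborel {0..1}"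

text \<open>A density is a function on \<open>[0,1]\<close>; its values elsewhere are irrelevant.\<close>

definition densities :: "(real \<Rightarrow> real) set" where
  "densities = {f \<in> borel_measurable unit_lborel.
     (\<forall>x\<in>{0..1}. 0 \<le> f x) \<and> (\<integral>\<^sup>+ x. ennreal (f x) \<partial>unit_lborel) = 1}"

text \<open>Functions that agree almost everywhere are not identified, so this topology is given by
  a pseudometric and is not Hausdorff; its Borel sets are unions of a.e.-equality classes.\<close>

definition L1_topology :: "(real \<Rightarrow> real) topology" where
  "L1_topology = topology_generated_by
     {{g \<in> densities. (\<integral>x. \<bar>f x - g x\<bar> \<partial>unit_lborel) < r} | f r. f \<in> densities \<and> 0 < r}"

text \<open>If \<open>K\<close> takes large values, \<open>\<theta> \<mapsto> K x \<theta>\<close> may fail to be integrable for \<open>x\<close> in a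
  Lebesgue null set, where the Bochner integral below is 0 instead of \<open>\<infinity>\<close>.\<close>

definition mixture_density :: "(real \<Rightarrow> 'a \<Rightarrow> real) \<Rightarrow> 'a measure \<Rightarrow> real \<Rightarrow> real" where
  "mixture_density K P = (\<lambda>x. \<integral>\<theta>. K x \<theta> \<partial>P)"

definition kernel_mixture_prior ::
  "(real \<Rightarrow> 'a \<Rightarrow> real) \<Rightarrow> 'a measure measure \<Rightarrow> (real \<Rightarrow> real) measure" where
  "kernel_mixture_prior K M = distr M (borel_of L1_topology) (mixture_density K)"

text \<open>The value of \<open>a log (a / b)\<close> for \<open>a, b \<ge> 0\<close>, with \<open>0 log (0 / b) = 0\<close> and
  \<open>a log (a / 0) = \<infinity>\<close> for \<open>a > 0\<close>.\<close>

definition kl_integrand :: "real \<Rightarrow> real \<Rightarrow> ereal" where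
  "kl_integrand a b =
     (if a = 0 then 0 else if b = 0 then \<infinity> else ereal (a * ln (a / b)))"

text \<open>Integral of the positive part minus integral of the negative part. For densities the
  latter is at most 1, because \<open>a log (b / a) \<le> b\<close>.\<close>

definition KL :: "(real \<Rightarrow> real) \<Rightarrow> (real \<Rightarrow> real) \<Rightarrow> ereal" where
  "KL f0 f =
     enn2ereal (\<integral>\<^sup>+ x. e2ennreal (kl_integrand (f0 x) (f x)) \<partial>unit_lborel)
     - enn2ereal (\<integral>\<^sup>+ x. e2ennreal (- kl_integrand (f0 x) (f x)) \<partial>unit_lborel)"

definition KL_property :: "(real \<Rightarrow> real) \<Rightarrow> (real \<Rightarrow> real) measure \<Rightarrow> bool" where
  "KL_property f0 M \<longleftrightarrow>
     (\<forall>\<epsilon>::real. \<epsilon> > 0 \<longrightarrow> emeasure M {f \<in> space M. KL f0 f < ereal \<epsilon>} > 0)"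

definition tri_kernel :: "real \<Rightarrow> nat \<Rightarrow> nat \<Rightarrow> real" where
  "tri_kernel x m n =
     (if m = 0 then
        (if 0 < x \<and> x < 1 / real n then 2 * real n - 2 * (real n)\<^sup>2 * x else 0)
      else if m = n then
        (if 1 - 1 / real n < x \<and> x < 1 then 2 * real n + 2 * (real n)\<^sup>2 * (x - 1) else 0)
      else
        (if (real m - 1) / real n < x \<and> x < real m / real n
         then (real n)\<^sup>2 * (x - real m / real n) + real n
         else if real m / real n < x \<and> x < (real m + 1) / real n
         then - ((real n)\<^sup>2) * (x - real m / real n) + real n
         else 0))"

definition tri_params :: "(nat \<times> nat) set" where
  "tri_params = {(m, n). 1 \<le> n \<and> m \<le> n}"

lemma topspace_weak_topology: "topspace (weak_topology X) = prob_measures X"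
proof -
  have "prob_measures X \<in> {{P \<in> prob_measures X. (\<integral>t. h t \<partial>P) \<in> V} | (h :: 'a \<Rightarrow> real) V.
        continuous_map X euclideanreal h \<and> bounded (h ` topspace X) \<and> open V}"
    by (rule CollectI, rule exI[of _ "\<lambda>_. 0"], rule exI[of _ UNIV])
       (auto simp: bounded_iff)
  then show ?thesis
    unfolding weak_topology_def topology_generated_by_topspace by blast
qed

lemma topspace_L1_topology: "topspace L1_topology = densities"
proof -
  have "\<exists>r>0. (\<integral>x. \<bar>f x - f x\<bar> \<partial>unit_lborel) < (r::real)" for f :: "real \<Rightarrow> real"
    by (rule exI[of _ 1]) simp
  then show ?thesis
    unfolding L1_topology_def topology_generated_by_topspace by blast
qed

end

theory Submission
  imports Defs
begin

text \<open>
  If a mixing measure \<open>P\<close> gives mass more than \<open>v a\<close> to every \<open>a\<close> in a finite set \<open>A\<close> of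
  parameters, then \<open>f\<^sub>P \<ge> (\<Sum>a\<in>A. v a * K x a)\<close> almost everywhere, because the kernels are nonnegative.
  Such measures \<open>P\<close> form a weakly open set, since the parameter space is discrete. So it
  suffices to find, for every \<open>C > 1\<close>, finitely many weights \<open>v \<ge> 0\<close> of total less than 1 with
  \<open>f\<^sub>0 \<le> C * (\<Sum>a\<in>A. v a * K x a)\<close> almost everywhere. The open set is then not empty, because the
  weights leave mass to spare, hence it has positive prior mass, and on it
  \<open>\<integral>f\<^sub>0 log (f\<^sub>0 / f\<^sub>P) \<le> log C\<close>. Where \<open>f\<^sub>0\<close> vanishes the bound is trivial, so zeros of \<open>f\<^sub>0\<close> do no
  harm. This is \<open>KL_property_kernel_mixture_prior\<close>, which holds for every countable family of
  densities.

  For the triangular kernels the bound comes from piecewise linear interpolation. Up to their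
  height they are the hat functions of the grid \<open>m / n\<close>, which form a partition of unity. When
  \<open>f\<^sub>0\<close> varies by at most \<open>\<eta>\<close> over distance \<open>1 / n\<close>, the interpolant of \<open>f\<^sub>0 + \<eta>\<close> lies between \<open>f\<^sub>0\<close> and
  \<open>f\<^sub>0 + 2 * \<eta>\<close>. It is a combination of kernels whose coefficients sum to its integral, hence to at
  most \<open>1 + 2 * \<eta>\<close>; dividing by \<open>C = 1 + 3 * \<eta>\<close> makes the sum less than 1
  (\<open>finite_mixture_of_tri_kernels_dominates\<close>).

  Measurability must also be proved, since the prior on densities is an image measure and the
  Kullback-Leibler neighbourhoods have to be events. The map \<open>P \<mapsto> f\<^sub>P\<close> is continuous from the weak topology
  to \<open>L\<^sup>1\<close>, by the same minorant \<open>\<Sum>a\<in>A. v a * K x a\<close> with \<open>A\<close> carrying almost all the mass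
  (\<open>continuous_map_mixture_density\<close>). The divergence from \<open>f\<^sub>0\<close> is lower semicontinuous on \<open>L\<^sup>1\<close> by
  Fatou's lemma (\<open>openin_KL_superlevel\<close>), hence Borel.
\<close>

section \<open>Borel sets and the weak topology over a discrete space\<close>

lemma space_borel_of [simp]: "space (borel_of X) = topspace X"
  unfolding borel_of_def by (rule space_measure_of) (auto dest: openin_subset)

lemma sets_borel_of: "sets (borel_of X) = sigma_sets (topspace X) {U. openin X U}"
  unfolding borel_of_def by (rule sets_measure_of) (auto dest: openin_subset)

lemma openin_imp_sets_borel_of: "openin X U \<Longrightarrow> U \<in> sets (borel_of X)"
  unfolding sets_borel_of by (simp add: sigma_sets.Basic)

lemma continuous_map_measurable_borel_of:
  assumes "continuous_map X Y f"
  shows "f \<in> borel_of X \<rightarrow>\<^sub>M borel_of Y"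
proof (rule measurable_sigma_sets[OF sets_borel_of])
  show "{U. openin Y U} \<subseteq> Pow (topspace Y)"
    by (auto dest: openin_subset)
  show "f \<in> space (borel_of X) \<rightarrow> topspace Y"
    using assms by (auto dest: continuous_map_image_subset_topspace)
next
  fix U assume "U \<in> {U. openin Y U}"
  then have "openin X {x \<in> topspace X. f x \<in> U}"
    using assms by (simp add: openin_continuous_map_preimage)
  then show "f -` U \<inter> space (borel_of X) \<in> sets (borel_of X)"
    by (auto simp: vimage_def Int_def conj_commute intro: openin_imp_sets_borel_of)
qed

lemma prob_measures_discrete_topology:
  "prob_measures (discrete_topology S) = {P. prob_space P \<and> sets P = Pow S}"
proof -
  have "{U. openin (discrete_topology S) U} = Pow S"
    by auto
  then have "sets (borel_of (discrete_topology S)) = Pow S"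
    by (simp add: sets_borel_of sigma_algebra.sigma_sets_eq[OF sigma_algebra_Pow])
  then show ?thesis by (simp add: prob_measures_def)
qed

text \<open>On a discrete space the indicator of a point is a bounded continuous test function, so
  lower bounds on finitely many point masses are weakly open conditions.\<close>
lemma openin_weak_topology_point_masses:
  assumes "finite A" "A \<subseteq> S"
  shows "openin (weak_topology (discrete_topology S))
    {P \<in> prob_measures (discrete_topology S). \<forall>a\<in>A. v a < measure P {a}}"
  using assms
proof (induction A rule: finite_induct)
  case empty
  then show ?case
    using openin_topspace[of "weak_topology (discrete_topology S)"]
    by (simp add: topspace_weak_topology)
next
  case (insert a A)
  let ?X = "discrete_topology S"
  let ?h = "indicat_real {a}"
  have "openin (weak_topology ?X) {P \<in> prob_measures ?X. (\<integral>t. ?h t \<partial>P) \<in> {v a<..}}"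
    unfolding weak_topology_def
  proof (rule topology_generated_by_Basis, rule CollectI, intro exI conjI)
    show "bounded (?h ` topspace ?X)"
      by (rule finite_imp_bounded, rule finite_subset[of _ "{0, 1}"]) (auto simp: indicator_def)
  qed (rule refl, simp_all)
  moreover have "(\<integral>t. ?h t \<partial>P) = measure P {a}" if "P \<in> prob_measures ?X" for P
  proof -
    have "space P = S"
      using that sets_eq_imp_space_eq[of P "count_space S"]
      by (simp add: prob_measures_discrete_topology)
    then show ?thesis using insert.prems by simp
  qed
  ultimately have "openin (weak_topology ?X) {P \<in> prob_measures ?X. v a < measure P {a}}"
    by (simp cong: conj_cong)
  with insert have "openin (weak_topology ?X) ({P \<in> prob_measures ?X. v a < measure P {a}} \<inter>
      {P \<in> prob_measures ?X. \<forall>a\<in>A. v a < measure P {a}})"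
    by (intro openin_Int) auto
  then show ?case
    by (rule back_subst[where P = "openin _"]) auto
qed

section \<open>Densities on the unit interval\<close>

lemma densities_integral:
  assumes "f \<in> densities"
  shows "integrable unit_lborel f" "(\<integral>x. f x \<partial>unit_lborel) = 1"
proof -
  have [measurable]: "f \<in> borel_measurable unit_lborel" and nn: "(\<integral>\<^sup>+ x. ennreal (f x) \<partial>unit_lborel) = 1"
    using assms by (auto simp: densities_def)
  have pos: "AE x in unit_lborel. 0 \<le> f x"
    using assms by (intro AE_I2) (auto simp: densities_def space_restrict_space)
  show int: "integrable unit_lborel f"
    by (rule integrableI_nonneg[OF _ pos]) (simp_all add: nn)
  show "(\<integral>x. f x \<partial>unit_lborel) = 1"
    using nn_integral_eq_integral[OF int pos] nn by simp
qed

lemma openin_L1_ball: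
  assumes "f \<in> densities" "0 < r"
  shows "openin L1_topology {g \<in> densities. (\<integral>x. \<bar>f x - g x\<bar> \<partial>unit_lborel) < r}"
  unfolding L1_topology_def by (rule topology_generated_by_Basis) (use assms in blast)

text \<open>Both densities exceed \<open>l\<close> by functions of integral \<open>1 - \<integral>l\<close>. Thus one-sided bounds alone
  control the \<open>L\<^sup>1\<close> distance.\<close>
lemma L1_distance_common_minorant:
  assumes f: "f \<in> densities" and g: "g \<in> densities" and l: "integrable unit_lborel l"
    and "AE x in unit_lborel. l x \<le> f x" "AE x in unit_lborel. l x \<le> g x"
  shows "(\<integral>x. \<bar>f x - g x\<bar> \<partial>unit_lborel) \<le> 2 * (1 - (\<integral>x. l x \<partial>unit_lborel))"
proof -
  note [simp] = densities_integral[OF f] densities_integral[OF g] l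
  have "(\<integral>x. \<bar>f x - g x\<bar> \<partial>unit_lborel) \<le> (\<integral>x. (f x - l x) + (g x - l x) \<partial>unit_lborel)"
    using assms(4,5) by (intro integral_mono_AE) (auto elim!: eventually_elim2)
  also have "\<dots> = 2 * (1 - (\<integral>x. l x \<partial>unit_lborel))"
    by simp
  finally show ?thesis .
qed

section \<open>Lower semicontinuity of the Kullback-Leibler divergence\<close>

text \<open>The Bregman form \<open>a log (a / b) + b - a\<close> of the divergence. Its integral over two densities is
  the divergence, as \<open>b - a\<close> integrates to 0, and being nonnegative it is
  accessible to Fatou's lemma.\<close>
definition kl_excess :: "real \<Rightarrow> real \<Rightarrow> ennreal" where
  "kl_excess a b = e2ennreal (kl_integrand a b + ereal (b - a))"

lemma kl_integrand_bound:
  assumes "0 \<le> a" "0 \<le> b"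
  shows "ereal (a - b) \<le> kl_integrand a b"
proof (cases "a = 0 \<or> b = 0")
  case False
  with assms have "0 < a" "0 < b" by auto
  then have "ln (b / a) \<le> b / a - 1"
    by (intro ln_le_minus_one) simp
  then have "a * ln (b / a) \<le> b - a"
    using \<open>0 < a\<close> by (simp add: field_simps)
  moreover have "ln (b / a) = - ln (a / b)"
    using \<open>0 < a\<close> \<open>0 < b\<close> by (simp add: ln_div)
  ultimately show ?thesis
    using False by (simp add: kl_integrand_def)
qed (use assms in \<open>auto simp: kl_integrand_def\<close>)

text \<open>The identity \<open>excess = kl + b - a\<close>, written without subtraction so that it can be integrated
  in the extended nonnegative reals.\<close>
lemma kl_excess_decomposition:
  assumes "0 \<le> a" "0 \<le> b"
  shows "kl_excess a b + ennreal a + e2ennreal (- kl_integrand a b)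
    = e2ennreal (kl_integrand a b) + ennreal b"
    and "e2ennreal (- kl_integrand a b) \<le> ennreal b"
proof -
  have "ereal (a - b) \<le> kl_integrand a b"
    using assms by (rule kl_integrand_bound)
  then consider (real) r where "kl_integrand a b = ereal r" "a - b \<le> r" | (PInf) "kl_integrand a b = \<infinity>"
    by (cases "kl_integrand a b") auto
  then show "kl_excess a b + ennreal a + e2ennreal (- kl_integrand a b)
    = e2ennreal (kl_integrand a b) + ennreal b"
  proof cases
    case real
    then show ?thesis
      using assms unfolding kl_excess_def
      by (cases "r \<le> 0") (simp_all add: e2ennreal_ereal ennreal_neg flip: ennreal_plus)
  qed (simp add: kl_excess_def)
  show "e2ennreal (- kl_integrand a b) \<le> ennreal b"
    using assms \<open>ereal (a - b) \<le> kl_integrand a b\<close>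
    by (cases "kl_integrand a b") (auto simp: e2ennreal_ereal e2ennreal_neg intro!: ennreal_leI)
qed

lemma measurable_kl_integrand [measurable]:
  assumes [measurable]: "f \<in> borel_measurable M" "g \<in> borel_measurable M"
  shows "(\<lambda>x. kl_integrand (f x) (g x)) \<in> borel_measurable M"
  unfolding kl_integrand_def by measurable

lemma measurable_kl_excess [measurable]:
  assumes [measurable]: "f \<in> borel_measurable M" "g \<in> borel_measurable M"
  shows "(\<lambda>x. kl_excess (f x) (g x)) \<in> borel_measurable M"
  unfolding kl_excess_def by measurable

lemma KL_eq_nn_integral_kl_excess:
  assumes "f \<in> densities" "g \<in> densities"
  shows "KL f g = enn2ereal (\<integral>\<^sup>+x. kl_excess (f x) (g x) \<partial>unit_lborel)"
proof -
  have [measurable]: "f \<in> borel_measurable unit_lborel" "g \<in> borel_measurable unit_lborel"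
    and one: "(\<integral>\<^sup>+x. ennreal (f x) \<partial>unit_lborel) = 1" "(\<integral>\<^sup>+x. ennreal (g x) \<partial>unit_lborel) = 1"
    and pos: "\<And>x. x \<in> {0..1} \<Longrightarrow> 0 \<le> f x" "\<And>x. x \<in> {0..1} \<Longrightarrow> 0 \<le> g x"
    using assms by (auto simp: densities_def)
  let ?e = "\<lambda>x. kl_excess (f x) (g x)"
  let ?p = "\<lambda>x. e2ennreal (kl_integrand (f x) (g x))"
  let ?q = "\<lambda>x. e2ennreal (- kl_integrand (f x) (g x))"
  let ?I = "\<lambda>h. \<integral>\<^sup>+x. h x \<partial>unit_lborel"
  have "?I (\<lambda>x. ?e x + ennreal (f x) + ?q x) = ?I (\<lambda>x. ?p x + ennreal (g x))"
    by (rule nn_integral_cong) (simp add: kl_excess_decomposition(1) pos space_restrict_space)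
  then have eq: "?I ?e + 1 + ?I ?q = ?I ?p + 1"
    by (simp add: nn_integral_add one)
  have "?I ?q \<le> ?I (\<lambda>x. ennreal (g x))"
    by (rule nn_integral_mono) (simp add: kl_excess_decomposition(2) pos space_restrict_space)
  then have fin: "?I ?q < \<infinity>"
    by (simp add: one le_less_trans)
  have "?I ?p = ?I ?e + ?I ?q"
  proof -
    have "1 + ?I ?p = 1 + (?I ?e + ?I ?q)"
      using eq by (simp add: ac_simps)
    then show ?thesis by (simp add: ennreal_add_left_cancel)
  qed
  then show ?thesis
    using fin unfolding KL_def
    by (cases "?I ?q"; cases "?I ?e") (auto simp: plus_ennreal.rep_eq enn2ereal_ennreal simp flip: ennreal_plus)
qed

text \<open>Continuity up to the boundary needs the value \<open>\<infinity>\<close> at \<open>b = 0\<close> when \<open>a > 0\<close>.\<close>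
lemma tendsto_kl_integrand:
  assumes a: "0 \<le> a" and nonneg: "\<And>n. 0 \<le> b n" and lim: "b \<longlonglongrightarrow> c"
  shows "(\<lambda>n. kl_integrand a (b n)) \<longlonglongrightarrow> kl_integrand a c"
proof (cases "a = 0")
  case False
  with a have a: "0 < a" by simp
  have "0 \<le> c" using nonneg lim by (simp add: LIMSEQ_le_const)
  show ?thesis
  proof (cases "c = 0")
    case True
    show ?thesis
      unfolding True kl_integrand_def using False
    proof (simp add: tendsto_PInfty, intro allI)
      fix r :: real
      have "\<forall>\<^sub>F n in sequentially. b n < a * exp (- r / a)"
        using lim a True by (intro order_tendstoD(2)) auto
      then show "\<forall>\<^sub>F n in sequentially. b n \<noteq> 0 \<longrightarrow> r < a * ln (a / b n)"
      proof eventually_elim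
        case (elim n)
        show ?case
        proof
          assume "b n \<noteq> 0"
          with nonneg[of n] have "0 < b n" by simp
          then have "ln (b n) < ln (a * exp (- r / a))"
            using elim a by (simp del: ln_mult)
          also have "\<dots> = ln a - r / a"
            using a by (simp add: ln_mult)
          finally have "r / a < ln (a / b n)"
            using a \<open>0 < b n\<close> by (simp add: ln_div)
          then show "r < a * ln (a / b n)"
            using a by (simp add: field_simps)
        qed
      qed
    qed
  next
    case False
    with \<open>0 \<le> c\<close> have "0 < c" by simp
    have "(\<lambda>n. ereal (a * ln (a / b n))) \<longlonglongrightarrow> ereal (a * ln (a / c))"
      using lim a \<open>0 < c\<close> by (intro tendsto_intros) auto
    moreover have "\<forall>\<^sub>F n in sequentially. 0 < b n"
      using lim \<open>0 < c\<close> by (rule order_tendstoD)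
    then have "\<forall>\<^sub>F n in sequentially. ereal (a * ln (a / b n)) = kl_integrand a (b n)"
      by eventually_elim (use a in \<open>simp add: kl_integrand_def\<close>)
    ultimately have "(\<lambda>n. kl_integrand a (b n)) \<longlonglongrightarrow> ereal (a * ln (a / c))"
      by (rule Lim_transform_eventually)
    then show ?thesis
      using a \<open>0 < c\<close> by (simp add: kl_integrand_def)
  qed
qed (simp add: kl_integrand_def)

lemma tendsto_kl_excess:
  assumes "0 \<le> a" "\<And>n. 0 \<le> b n" "b \<longlonglongrightarrow> c"
  shows "(\<lambda>n. kl_excess a (b n)) \<longlonglongrightarrow> kl_excess a c"
  unfolding kl_excess_def
  by (intro tendsto_e2ennrealI tendsto_add_ereal_general2 tendsto_kl_integrand tendsto_intros assms) simp

text \<open>Otherwise some sequence of densities converges in \<open>L\<^sup>1\<close> to \<open>g\<close> with divergences at most \<open>t\<close>. A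
  subsequence converges almost everywhere, and Fatou's lemma bounds the divergence of \<open>g\<close> by \<open>t\<close>.\<close>
lemma openin_KL_superlevel:
  assumes f: "f \<in> densities"
  shows "openin L1_topology {g \<in> densities. t < (\<integral>\<^sup>+x. kl_excess (f x) (g x) \<partial>unit_lborel)}"
    (is "openin _ ?U")
proof (subst openin_subopen, intro ballI)
  let ?I = "\<lambda>g. \<integral>\<^sup>+x. kl_excess (f x) (g x) \<partial>unit_lborel"
  fix g assume "g \<in> ?U"
  then have g: "g \<in> densities" "t < ?I g" by auto
  have "\<exists>r>0. {h \<in> densities. (\<integral>x. \<bar>g x - h x\<bar> \<partial>unit_lborel) < r} \<subseteq> ?U"
  proof (rule ccontr)
    assume "\<not> ?thesis"
    then have "\<exists>h\<in>densities. (\<integral>x. \<bar>g x - h x\<bar> \<partial>unit_lborel) < r \<and> ?I h \<le> t" if "0 < r" for r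
      using that by (fastforce simp: not_less)
    then have "\<exists>h\<in>densities. (\<integral>x. \<bar>g x - h x\<bar> \<partial>unit_lborel) < inverse (Suc n) \<and> ?I h \<le> t" for n
      by simp
    then obtain h where h: "\<And>n. h n \<in> densities" "\<And>n. ?I (h n) \<le> t"
      and dist: "\<And>n. (\<integral>x. \<bar>g x - h n x\<bar> \<partial>unit_lborel) < inverse (Suc n)"
      by metis
    have [measurable]: "f \<in> borel_measurable unit_lborel" "h n \<in> borel_measurable unit_lborel" for n
      using f h by (auto simp: densities_def)
    have "(\<lambda>n. \<integral>x. norm (g x - h n x) \<partial>unit_lborel) \<longlonglongrightarrow> 0"
      by (rule tendsto_sandwich[OF _ _ tendsto_const LIMSEQ_inverse_real_of_nat])
         (use dist in \<open>auto intro!: always_eventually less_imp_le\<close>)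
    then obtain r :: "nat \<Rightarrow> nat" where r: "AE x in unit_lborel. (\<lambda>n. g x - h (r n) x) \<longlonglongrightarrow> 0"
      using tendsto_L1_AE_subseq[of unit_lborel "\<lambda>n x. g x - h n x"] g h
      by (auto simp: densities_integral)
    have "?I g \<le> (\<integral>\<^sup>+x. liminf (\<lambda>n. kl_excess (f x) (h (r n) x)) \<partial>unit_lborel)"
    proof (rule nn_integral_mono_AE)
      show "AE x in unit_lborel. kl_excess (f x) (g x) \<le> liminf (\<lambda>n. kl_excess (f x) (h (r n) x))"
        using r AE_space
      proof eventually_elim
        case (elim x)
        have "(\<lambda>n. g x - (g x - h (r n) x)) \<longlonglongrightarrow> g x - 0"
          using elim by (intro tendsto_intros)
        then have "(\<lambda>n. kl_excess (f x) (h (r n) x)) \<longlonglongrightarrow> kl_excess (f x) (g x)"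
          using elim f h by (intro tendsto_kl_excess) (auto simp: densities_def space_restrict_space)
        then show ?case
          by (simp add: lim_imp_Liminf)
      qed
    qed
    also have "\<dots> \<le> liminf (\<lambda>n. ?I (h (r n)))"
      by (rule nn_integral_liminf) measurable
    also have "\<dots> \<le> liminf (\<lambda>n::nat. t)"
      by (intro Liminf_mono always_eventually allI h)
    also have "\<dots> = t"
      by (simp add: Liminf_const)
    finally show False
      using g by simp
  qed
  then obtain r where "0 < r" "{h \<in> densities. (\<integral>x. \<bar>g x - h x\<bar> \<partial>unit_lborel) < r} \<subseteq> ?U"
    by blast
  with g show "\<exists>T. openin L1_topology T \<and> g \<in> T \<and> T \<subseteq> ?U"
    by (intro exI[of _ "{h \<in> densities. (\<integral>x. \<bar>g x - h x\<bar> \<partial>unit_lborel) < r}"])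
       (auto intro: openin_L1_ball)
qed

lemma measurable_KL:
  assumes f: "f \<in> densities"
  shows "(\<lambda>g. KL f g) \<in> borel_measurable (borel_of L1_topology)"
proof -
  have [measurable]: "(\<lambda>g. \<integral>\<^sup>+x. kl_excess (f x) (g x) \<partial>unit_lborel)
    \<in> borel_measurable (borel_of L1_topology)"
    by (rule borel_measurableI_greater)
       (simp add: topspace_L1_topology openin_imp_sets_borel_of openin_KL_superlevel[OF f])
  have "(\<lambda>g. enn2ereal (\<integral>\<^sup>+x. kl_excess (f x) (g x) \<partial>unit_lborel))
    \<in> borel_measurable (borel_of L1_topology)"
    by measurable
  then show ?thesis
    by (rule measurable_cong[THEN iffD2, rotated])
       (simp add: topspace_L1_topology KL_eq_nn_integral_kl_excess f)
qed

text \<open>Dropping the negative part of the integrand increases the divergence, and the positive part is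
  at most \<open>f * ln C\<close>.\<close>
lemma KL_le_ln_ratio_bound:
  assumes f: "f \<in> densities" and g: "g \<in> densities" and C: "1 \<le> C"
    and bound: "AE x in unit_lborel. f x \<le> C * g x"
  shows "KL f g \<le> ereal (ln C)"
proof -
  have [measurable]: "f \<in> borel_measurable unit_lborel"
    and one: "(\<integral>\<^sup>+x. ennreal (f x) \<partial>unit_lborel) = 1"
    using f by (auto simp: densities_def)
  have "(\<integral>\<^sup>+x. e2ennreal (kl_integrand (f x) (g x)) \<partial>unit_lborel)
      \<le> (\<integral>\<^sup>+x. ennreal (ln C) * ennreal (f x) \<partial>unit_lborel)"
  proof (rule nn_integral_mono_AE)
    show "AE x in unit_lborel. e2ennreal (kl_integrand (f x) (g x)) \<le> ennreal (ln C) * ennreal (f x)"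
      using bound AE_space
    proof eventually_elim
      case (elim x)
      then have pos: "0 \<le> f x" "0 \<le> g x"
        using f g by (auto simp: densities_def space_restrict_space)
      show ?case
      proof (cases "f x = 0")
        case False
        with pos elim C have "0 < f x" "0 < g x"
          by (auto simp: less_le)
        then have "f x / g x \<le> C"
          using elim by (simp add: field_simps)
        then have "ln (f x / g x) \<le> ln C"
          using \<open>0 < f x\<close> \<open>0 < g x\<close> C by (intro ln_mono) auto
        then have "f x * ln (f x / g x) \<le> ln C * f x"
          using \<open>0 < f x\<close> by (simp add: mult.commute)
        then show ?thesis
          using \<open>0 < f x\<close> \<open>0 < g x\<close> C
          by (simp add: kl_integrand_def e2ennreal_ereal ennreal_leI flip: ennreal_mult)
      qed (simp add: kl_integrand_def)
    qed
  qed
  also have "\<dots> = ennreal (ln C)"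
    by (simp add: nn_integral_cmult one)
  finally have "enn2ereal (\<integral>\<^sup>+x. e2ennreal (kl_integrand (f x) (g x)) \<partial>unit_lborel) \<le> ereal (ln C)"
    using C by (metis enn2ereal_ennreal less_eq_ennreal.rep_eq ln_ge_zero)
  then show ?thesis
    unfolding KL_def by (meson enn2ereal_nonneg ereal_diff_le_self order_trans)
qed

section \<open>Mixtures of a countable family of densities\<close>

locale countable_density_family =
  fixes K :: "real \<Rightarrow> 'a \<Rightarrow> real" and S :: "'a set"
  assumes countable: "countable S"
    and density: "a \<in> S \<Longrightarrow> (\<lambda>x. K x a) \<in> densities"
begin

lemma nonneg: "a \<in> S \<Longrightarrow> x \<in> {0..1} \<Longrightarrow> 0 \<le> K x a"
  using density[of a] by (auto simp: densities_def)

lemma mixing_measure: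
  assumes "P \<in> prob_measures (discrete_topology S)"
  shows "prob_space P" "sets P = Pow S" "space P = S"
  using assms sets_eq_imp_space_eq[of P "count_space S"]
  by (simp_all add: prob_measures_discrete_topology)

lemma measurable_mixing:
  assumes P: "P \<in> prob_measures (discrete_topology S)"
  shows "(\<lambda>(x, a). K x a) \<in> borel_measurable (unit_lborel \<Otimes>\<^sub>M P)"
proof -
  have "(\<lambda>(x, a). K x a) \<in> borel_measurable (unit_lborel \<Otimes>\<^sub>M count_space S)"
    unfolding case_prod_unfold
  proof (rule measurable_compose_countable'[OF _ measurable_snd countable])
    fix a assume "a \<in> S"
    then have [measurable]: "(\<lambda>x. K x a) \<in> borel_measurable unit_lborel"
      using density by (auto simp: densities_def)
    show "(\<lambda>p. K (fst p) a) \<in> borel_measurable (unit_lborel \<Otimes>\<^sub>M count_space S)"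
      by measurable
  qed
  also have "borel_measurable (unit_lborel \<Otimes>\<^sub>M count_space S) = borel_measurable (unit_lborel \<Otimes>\<^sub>M P)"
    using mixing_measure[OF P] by (intro measurable_cong_sets sets_pair_measure_cong) simp_all
  finally show ?thesis .
qed

lemma nn_integral_mixture:
  assumes P: "P \<in> prob_measures (discrete_topology S)"
  shows "(\<integral>\<^sup>+x. (\<integral>\<^sup>+a. ennreal (K x a) \<partial>P) \<partial>unit_lborel) = 1"
proof -
  interpret P: prob_space P by (rule mixing_measure[OF P])
  interpret U: finite_measure unit_lborel
    by (rule finite_measureI) (simp add: space_restrict_space emeasure_restrict_space)
  interpret pair_sigma_finite unit_lborel P ..
  note [measurable] = measurable_mixing[OF P]
  have "(\<integral>\<^sup>+x. (\<integral>\<^sup>+a. ennreal (K x a) \<partial>P) \<partial>unit_lborel)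
      = (\<integral>\<^sup>+a. (\<integral>\<^sup>+x. ennreal (K x a) \<partial>unit_lborel) \<partial>P)"
    by (rule Fubini'[symmetric]) measurable
  also have "\<dots> = (\<integral>\<^sup>+a. 1 \<partial>P)"
    using density by (intro nn_integral_cong) (auto simp: mixing_measure[OF P] densities_def)
  finally show ?thesis by (simp add: P.emeasure_space_1)
qed

text \<open>The extended integral \<open>\<integral>\<^sup>+a. K x a \<partial>P\<close> has total integral 1 by Tonelli's theorem, so it is finite for
  almost all \<open>x\<close>. The exceptional points, where the Bochner integral defaults to 0, form a null set.\<close>
lemma AE_integrable_mixture:
  assumes P: "P \<in> prob_measures (discrete_topology S)"
  shows "AE x in unit_lborel. integrable P (K x)"
proof -
  interpret P: prob_space P by (rule mixing_measure[OF P])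
  note [measurable] = measurable_mixing[OF P]
  have "AE x in unit_lborel. (\<integral>\<^sup>+a. ennreal (K x a) \<partial>P) \<noteq> \<infinity>"
    by (rule nn_integral_PInf_AE) (measurable, simp add: nn_integral_mixture[OF P])
  then show ?thesis
    using AE_space
  proof eventually_elim
    case (elim x)
    then have "x \<in> {0..1}" by (simp add: space_restrict_space)
    then show ?case
      using elim nonneg by (intro integrableI_nonneg AE_I2)
        (auto simp: mixing_measure[OF P] measurable_def less_top simp del: atLeastAtMost_iff)
  qed
qed

lemma mixture_density_in_densities:
  assumes P: "P \<in> prob_measures (discrete_topology S)"
  shows "mixture_density K P \<in> densities"
proof -
  interpret P: prob_space P by (rule mixing_measure[OF P])
  note [measurable] = measurable_mixing[OF P]
  have "mixture_density K P \<in> borel_measurable unit_lborel"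
    unfolding mixture_density_def by measurable
  moreover have "0 \<le> mixture_density K P x" if "x \<in> {0..1}" for x
    unfolding mixture_density_def
    by (rule Bochner_Integration.integral_nonneg) (simp add: mixing_measure[OF P] nonneg[OF _ that])
  moreover have "(\<integral>\<^sup>+x. ennreal (mixture_density K P x) \<partial>unit_lborel)
      = (\<integral>\<^sup>+x. (\<integral>\<^sup>+a. ennreal (K x a) \<partial>P) \<partial>unit_lborel)"
  proof (rule nn_integral_cong_AE)
    show "AE x in unit_lborel. ennreal (mixture_density K P x) = (\<integral>\<^sup>+a. ennreal (K x a) \<partial>P)"
      using AE_integrable_mixture[OF P] AE_space
      by eventually_elim (auto simp: mixture_density_def mixing_measure[OF P] nonneg
          space_restrict_space intro!: nn_integral_eq_integral[symmetric] AE_I2)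
  qed
  ultimately show ?thesis
    by (simp add: densities_def nn_integral_mixture[OF P])
qed

text \<open>Discarding the mass outside \<open>A\<close> only decreases the mixture, because the kernels are nonnegative.\<close>
lemma mixture_density_lower_bound:
  assumes P: "P \<in> prob_measures (discrete_topology S)"
    and A: "finite A" "A \<subseteq> S" and v: "\<And>a. a \<in> A \<Longrightarrow> v a \<le> measure P {a}"
  shows "AE x in unit_lborel. (\<Sum>a\<in>A. v a * K x a) \<le> mixture_density K P x"
  using AE_integrable_mixture[OF P] AE_space
proof eventually_elim
  case (elim x)
  interpret P: prob_space P by (rule mixing_measure[OF P])
  note P = mixing_measure[OF P]
  have x: "x \<in> {0..1}" using elim by (simp add: space_restrict_space)
  have single: "integrable P (\<lambda>b. K x a * indicat_real {a} b)"
    "(\<integral>b. K x a * indicat_real {a} b \<partial>P) = K x a * measure P {a}" if "a \<in> A" for a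
    using that A by (auto simp: P subset_iff less_top[symmetric] intro!: integrable_mult_right integrable_real_indicator)
  have "(\<Sum>a\<in>A. v a * K x a) \<le> (\<Sum>a\<in>A. K x a * measure P {a})"
    using v nonneg[OF _ x] A by (intro sum_mono) (subst mult.commute, auto intro!: mult_left_mono)
  also have "\<dots> = (\<integral>b. (\<Sum>a\<in>A. K x a * indicat_real {a} b) \<partial>P)"
    by (subst Bochner_Integration.integral_sum) (auto simp only: single intro!: sum.cong)
  also have "\<dots> \<le> (\<integral>b. K x b \<partial>P)"
  proof (rule integral_mono)
    show "integrable P (\<lambda>b. \<Sum>a\<in>A. K x a * indicat_real {a} b)"
      using single by (intro Bochner_Integration.integrable_sum)
    show "(\<Sum>a\<in>A. K x a * indicat_real {a} b) \<le> K x b" if "b \<in> space P" for b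
    proof -
      have "(\<Sum>a\<in>A. K x a * indicat_real {a} b) = (\<Sum>a\<in>A. if a = b then K x b else 0)"
        by (intro sum.cong) auto
      then show ?thesis
        using A nonneg[OF _ x] that by (auto simp: P)
    qed
  qed (use elim in simp)
  finally show ?case by (simp add: mixture_density_def)
qed

lemma integral_finite_mixture:
  assumes "finite A" "A \<subseteq> S"
  shows "integrable unit_lborel (\<lambda>x. \<Sum>a\<in>A. v a * K x a)"
    and "(\<integral>x. (\<Sum>a\<in>A. v a * K x a) \<partial>unit_lborel) = (\<Sum>a\<in>A. v a)"
proof -
  have *: "integrable unit_lborel (\<lambda>x. K x a)" "(\<integral>x. K x a \<partial>unit_lborel) = 1" if "a \<in> A" for a
    using densities_integral[OF density] assms that by auto
  then show "integrable unit_lborel (\<lambda>x. \<Sum>a\<in>A. v a * K x a)"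
    by (intro Bochner_Integration.integrable_sum integrable_mult_right)
  show "(\<integral>x. (\<Sum>a\<in>A. v a * K x a) \<partial>unit_lborel) = (\<Sum>a\<in>A. v a)"
    using * by (simp add: Bochner_Integration.integral_sum)
qed

text \<open>The finite sets of parameters with small index exhaust the countable space.\<close>
lemma finite_set_almost_full:
  assumes P: "P \<in> prob_measures (discrete_topology S)" and "c < 1"
  obtains A where "finite A" "A \<subseteq> S" "c < (\<Sum>a\<in>A. measure P {a})"
proof -
  interpret P: prob_space P by (rule mixing_measure[OF P])
  note P = mixing_measure[OF P]
  define A where "A k = {a \<in> S. to_nat_on S a < k}" for k
  have fin: "finite (A k)" for k
    using finite_vimage_IntI[OF finite_lessThan[of k] inj_on_to_nat_on[OF countable]]
    by (rule rev_finite_subset) (auto simp: A_def)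
  have "(\<lambda>k. measure P (A k)) \<longlonglongrightarrow> measure P (\<Union>k. A k)"
    by (rule P.finite_Lim_measure_incseq) (auto simp: A_def P incseq_def)
  also have "(\<Union>k. A k) = space P"
    by (auto simp: A_def P)
  finally have "\<forall>\<^sub>F k in sequentially. c < measure P (A k)"
    using \<open>c < 1\<close> by (intro order_tendstoD(1)) (simp_all add: P.prob_space)
  then obtain k where "c < measure P (A k)"
    by (auto simp: eventually_sequentially)
  also have "measure P (A k) = (\<Sum>a\<in>A k. measure P {a})"
    using fin by (intro P.finite_measure_eq_sum_singleton) (auto simp: A_def P)
  finally show ?thesis
    using fin by (intro that[of "A k"]) (auto simp: A_def)
qed

text \<open>Near \<open>Q\<close>, lower bounds on the masses of finitely many points that carry almost all of \<open>Q\<close> give \<open>f\<^sub>P\<close> and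
  \<open>f\<^sub>Q\<close> a common minorant of integral close to 1. This is the fact that on a countable discrete
  space weak convergence is convergence in total variation.\<close>
lemma continuous_map_mixture_density:
  "continuous_map (weak_topology (discrete_topology S)) L1_topology (mixture_density K)"
  unfolding L1_topology_def
proof (rule continuous_on_generated_topo)
  let ?W = "weak_topology (discrete_topology S)"
  let ?d = "\<lambda>f g. \<integral>x. \<bar>f x - g x\<bar> \<partial>unit_lborel"
  show "mixture_density K ` topspace ?W
      \<subseteq> \<Union> {{g \<in> densities. ?d f g < r} |f r. f \<in> densities \<and> 0 < r}"
    using topspace_L1_topology
    by (auto simp: L1_topology_def topology_generated_by_topspace topspace_weak_topology
        mixture_density_in_densities)
  fix B assume "B \<in> {{g \<in> densities. ?d f g < r} |f r. f \<in> densities \<and> 0 < r}"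
  then obtain f r where f: "f \<in> densities" "0 < r" and B: "B = {g \<in> densities. ?d f g < r}"
    by blast
  show "openin ?W (mixture_density K -` B \<inter> topspace ?W)" (is "openin ?W ?V")
  proof (subst openin_subopen, intro ballI)
    fix Q assume "Q \<in> ?V"
    then have Q: "Q \<in> prob_measures (discrete_topology S)" and close: "?d f (mixture_density K Q) < r"
      by (auto simp: B topspace_weak_topology)
    define s where "s = r - ?d f (mixture_density K Q)"
    have "0 < s" using close by (simp add: s_def)
    then obtain A where A: "finite A" "A \<subseteq> S" and mass: "1 - s / 4 < (\<Sum>a\<in>A. measure Q {a})"
      using finite_set_almost_full[OF Q, of "1 - s / 4"] by auto
    \<comment> \<open>The slack keeps \<open>Q\<close> itself inside the neighbourhood and costs at most \<open>s / 4\<close> in total.\<close>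
    define v where "v a = measure Q {a} - s / (4 * (card A + 1))" for a
    have "(\<Sum>a\<in>A. v a) = (\<Sum>a\<in>A. measure Q {a}) - s * card A / (4 * (card A + 1))"
      by (simp add: v_def sum_subtractf)
    moreover have "s * card A / (4 * (card A + 1)) \<le> s / 4"
      using \<open>0 < s\<close> by (simp add: field_simps)
    ultimately have v_sum: "1 - s / 2 < (\<Sum>a\<in>A. v a)"
      using mass by linarith
    have v_less: "v a < measure Q {a}" for a
      using \<open>0 < s\<close> by (simp add: v_def)
    define T where "T = {P \<in> prob_measures (discrete_topology S). \<forall>a\<in>A. v a < measure P {a}}"
    have "T \<subseteq> ?V"
    proof
      fix P assume "P \<in> T"
      then have P: "P \<in> prob_measures (discrete_topology S)" and v_P: "\<And>a. a \<in> A \<Longrightarrow> v a < measure P {a}"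
        by (auto simp: T_def)
      note dens = mixture_density_in_densities[OF P] mixture_density_in_densities[OF Q]
      have "?d (mixture_density K Q) (mixture_density K P) \<le> 2 * (1 - (\<Sum>a\<in>A. v a))"
        using L1_distance_common_minorant[OF dens(2,1) integral_finite_mixture(1)[OF A, of v]]
          mixture_density_lower_bound[OF P A, of v] mixture_density_lower_bound[OF Q A, of v] v_P v_less
        by (simp add: integral_finite_mixture(2)[OF A] less_imp_le)
      also have "\<dots> < s" using v_sum by simp
      finally have near: "?d (mixture_density K Q) (mixture_density K P) < s" .
      note [simp] = densities_integral(1)[OF f(1)] densities_integral(1)[OF dens(1)]
        densities_integral(1)[OF dens(2)]
      have "?d f (mixture_density K P) \<le> (\<integral>x. \<bar>f x - mixture_density K Q x\<bar>
          + \<bar>mixture_density K Q x - mixture_density K P x\<bar> \<partial>unit_lborel)"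
        by (intro integral_mono) auto
      also have "\<dots> = ?d f (mixture_density K Q) + ?d (mixture_density K Q) (mixture_density K P)"
        by (intro Bochner_Integration.integral_add) auto
      also have "\<dots> < r" using near by (simp add: s_def)
      finally show "P \<in> ?V"
        using P dens by (simp add: B topspace_weak_topology)
    qed
    moreover have "openin ?W T"
      unfolding T_def using A by (rule openin_weak_topology_point_masses)
    moreover have "Q \<in> T"
      using Q v_less by (simp add: T_def)
    ultimately show "\<exists>T. openin ?W T \<and> Q \<in> T \<and> T \<subseteq> ?V"
      by blast
  qed
qed

text \<open>The missing mass \<open>1 - (\<Sum>a\<in>A. v a)\<close> is spread evenly over \<open>A\<close>, which makes all bounds strict.\<close>
lemma mixing_measure_with_point_masses:
  assumes A: "finite A" "A \<subseteq> S" "A \<noteq> {}"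
    and v: "\<And>a. a \<in> A \<Longrightarrow> 0 \<le> v a" "(\<Sum>a\<in>A. v a) < 1"
  shows "\<exists>P\<in>prob_measures (discrete_topology S). \<forall>a\<in>A. v a < measure P {a}"
proof (intro bexI ballI)
  define p where "p a = (v a + (1 - (\<Sum>a\<in>A. v a)) / card A) * indicator A a" for a
  define P where "P = density (count_space S) (\<lambda>a. ennreal (p a))"
  have card: "0 < card A" using A by (simp add: card_gt_0_iff)
  have p: "0 \<le> p a" for a
    using v by (auto simp: p_def indicator_def)
  have p_sum: "(\<Sum>a\<in>A. p a) = 1"
    using card by (simp add: p_def sum.distrib)
  have em: "emeasure P B = (\<integral>\<^sup>+a. ennreal (p a) * indicator B a \<partial>count_space S)" if "B \<subseteq> S" for B
    unfolding P_def using that by (intro emeasure_density) auto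
  have "emeasure P (space P) = (\<integral>\<^sup>+a. ennreal (p a) * indicator S a \<partial>count_space S)"
    using em[of S] by (simp add: P_def)
  also have "\<dots> = (\<Sum>a\<in>A. ennreal (p a) * indicator S a)"
    using A by (intro nn_integral_count_space') (auto simp: p_def)
  also have "\<dots> = (\<Sum>a\<in>A. ennreal (p a))"
    using A by (intro sum.cong) auto
  also have "\<dots> = 1"
    using p p_sum by (simp add: sum_ennreal)
  finally have "prob_space P" by (rule prob_spaceI)
  then show "P \<in> prob_measures (discrete_topology S)"
    by (simp add: prob_measures_discrete_topology P_def)
  fix a assume a: "a \<in> A"
  then have "emeasure P {a} = (\<Sum>b\<in>{a}. ennreal (p b) * indicator {a} b)"
    using A em[of "{a}"] by (subst em) (auto intro!: nn_integral_count_space')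
  then have "measure P {a} = p a"
    using p by (simp add: measure_def)
  then show "v a < measure P {a}"
    using a v(2) card by (simp add: p_def)
qed

text \<open>A criterion for the Kullback-Leibler property that asks only for finite sub-probability
  mixtures dominating \<open>f\<close> up to a factor close to 1.\<close>
theorem KL_property_kernel_mixture_prior:
  assumes prior: "prior_on (weak_topology (discrete_topology S)) Prior"
    and support: "prob_measures (discrete_topology S)
      \<subseteq> support_of (weak_topology (discrete_topology S)) Prior"
    and f: "f \<in> densities"
    and approx: "\<And>C. 1 < C \<Longrightarrow> \<exists>A v. finite A \<and> A \<subseteq> S \<and> A \<noteq> {} \<and> (\<forall>a\<in>A. 0 \<le> v a) \<and> (\<Sum>a\<in>A. v a) < 1 \<and>
      (AE x in unit_lborel. f x \<le> C * (\<Sum>a\<in>A. v a * K x a))"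
  shows "KL_property f (kernel_mixture_prior K Prior)"
  unfolding KL_property_def
proof (intro allI impI)
  let ?W = "weak_topology (discrete_topology S)"
  let ?B = "borel_of L1_topology"
  let ?N = "kernel_mixture_prior K Prior"
  fix \<epsilon> :: real assume "0 < \<epsilon>"
  then have "1 < exp (\<epsilon> / 2)" by simp
  from approx[OF this] obtain A v where A: "finite A" "A \<subseteq> S" "A \<noteq> {}"
    and v: "\<And>a. a \<in> A \<Longrightarrow> 0 \<le> v a" "(\<Sum>a\<in>A. v a) < 1"
    and le: "AE x in unit_lborel. f x \<le> exp (\<epsilon> / 2) * (\<Sum>a\<in>A. v a * K x a)"
    by blast
  define T where "T = {P \<in> prob_measures (discrete_topology S). \<forall>a\<in>A. v a < measure P {a}}"
  have "sets Prior = sets (borel_of ?W)"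
    using prior by (simp add: prior_on_def)
  then have meas: "mixture_density K \<in> Prior \<rightarrow>\<^sub>M ?B" and space: "space Prior = prob_measures (discrete_topology S)"
    using continuous_map_measurable_borel_of[OF continuous_map_mixture_density]
      sets_eq_imp_space_eq[of Prior "borel_of ?W"]
    by (simp_all cong: measurable_cong_sets add: topspace_weak_topology)
  have T_open: "openin ?W T"
    unfolding T_def using A(1,2) by (rule openin_weak_topology_point_masses)
  obtain Q where "Q \<in> T"
    using mixing_measure_with_point_masses[OF A v] by (auto simp: T_def)
  then have T_pos: "0 < emeasure Prior T"
    using support T_open by (auto simp: support_of_def T_def)
  have KL_small: "KL f (mixture_density K P) < ereal \<epsilon>" if "P \<in> T" for P
  proof -
    have P: "P \<in> prob_measures (discrete_topology S)" "\<And>a. a \<in> A \<Longrightarrow> v a \<le> measure P {a}"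
      using that by (auto simp: T_def less_imp_le)
    have "AE x in unit_lborel. (\<Sum>a\<in>A. v a * K x a) \<le> mixture_density K P x"
      using P A by (intro mixture_density_lower_bound)
    with le have "AE x in unit_lborel. f x \<le> exp (\<epsilon> / 2) * mixture_density K P x"
    proof eventually_elim
      case (elim x)
      then show ?case
        by (meson exp_ge_zero mult_left_mono order_trans)
    qed
    then have "KL f (mixture_density K P) \<le> ereal (ln (exp (\<epsilon> / 2)))"
      using f mixture_density_in_densities[OF P(1)] \<open>0 < \<epsilon>\<close> by (intro KL_le_ln_ratio_bound) auto
    also have "\<dots> < ereal \<epsilon>" using \<open>0 < \<epsilon>\<close> by simp
    finally show ?thesis .
  qed
  let ?F = "{g \<in> space ?N. KL f g < ereal \<epsilon>}"
  have "space ?N = space ?B"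
    by (simp add: kernel_mixture_prior_def)
  then have F: "?F \<in> sets ?B"
    using borel_measurable_less[OF measurable_KL[OF f] borel_measurable_const[of "ereal \<epsilon>"]] by simp
  have "emeasure Prior T \<le> emeasure Prior (mixture_density K -` ?F \<inter> space Prior)"
  proof (rule emeasure_mono)
    show "T \<subseteq> mixture_density K -` ?F \<inter> space Prior"
      using KL_small by (auto simp: kernel_mixture_prior_def topspace_L1_topology T_def space
          mixture_density_in_densities)
    show "mixture_density K -` ?F \<inter> space Prior \<in> sets Prior"
      using meas F by (rule measurable_sets)
  qed
  then show "0 < emeasure ?N ?F"
    using T_pos meas F by (simp add: kernel_mixture_prior_def emeasure_distr)
qed

end

section \<open>Triangular kernels as hat functions\<close>

definition hat :: "real \<Rightarrow> real" where
  "hat t = max 0 (1 - \<bar>t\<bar>)"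

text \<open>The kernels at the ends of the interval are half-hats and have double height, to have mass 1.\<close>
definition tri_height :: "nat \<Rightarrow> nat \<Rightarrow> real" where
  "tri_height m n = (if m = 0 \<or> m = n then 2 * real n else real n)"

text \<open>As a second difference of the positive part, the hat function has sums over the grid that
  telescope and an antiderivative without case distinctions.\<close>
lemma hat_second_difference: "hat t = max 0 (t + 1) - 2 * max 0 t + max 0 (t - 1)"
  by (auto simp: hat_def max_def abs_if)

lemma sum_hat_eq_1:
  assumes "0 \<le> y" "y \<le> real n"
  shows "(\<Sum>m\<le>n. hat (y - real m)) = 1"
proof -
  define d where "d m = max 0 (y - real m + 1) - max 0 (y - real m)" for m
  have "(\<Sum>m\<le>n. hat (y - real m)) = (\<Sum>m\<le>n. d m - d (Suc m))"
    by (intro sum.cong) (simp_all add: hat_second_difference d_def algebra_simps)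
  also have "\<dots> = d 0 - d (Suc n)"
    by (rule sum_telescope)
  also have "\<dots> = 1"
    using assms by (simp add: d_def)
  finally show ?thesis .
qed

lemma DERIV_half_square_positive_part:
  "((\<lambda>t. (max 0 t)\<^sup>2 / 2) has_real_derivative max 0 t) (at t)" for t :: real
proof -
  consider "t < 0" | "0 < t" | "t = 0" by linarith
  then show ?thesis
  proof cases
    case 1
    have "((\<lambda>_. 0) has_real_derivative max 0 t) (at t)"
      using 1 by (auto intro!: derivative_eq_intros)
    then show ?thesis
      by (rule has_field_derivative_transform_within_open[where S = "{..<0}"]) (use 1 in auto)
  next
    case 2
    have "((\<lambda>t. t\<^sup>2 / 2) has_real_derivative max 0 t) (at t)"
      using 2 by (auto intro!: derivative_eq_intros)
    then show ?thesis
      by (rule has_field_derivative_transform_within_open[where S = "{0<..}"]) (use 2 in auto)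
  next
    case 3
    show ?thesis
      unfolding 3 CARAT_DERIV
    proof (intro exI conjI)
      show "isCont (\<lambda>z::real. max 0 z / 2) 0"
        by (intro continuous_intros) simp
    qed (auto simp: max_def power2_eq_square)
  qed
qed

lemma nn_integral_hat:
  assumes "1 \<le> n" "m \<le> n"
  shows "(\<integral>\<^sup>+x. ennreal (tri_height m n * hat (real n * x - real m)) \<partial>unit_lborel) = 1"
proof -
  define p where "p t = (max 0 t)\<^sup>2 / 2" for t :: real
  define H where "H t = p (t + 1) - 2 * p t + p (t - 1)" for t
  have p: "(p has_real_derivative max 0 t) (at t)" for t
    unfolding p_def by (rule DERIV_half_square_positive_part)
  have H: "(H has_real_derivative hat t) (at t)" for t
  proof -
    have shift: "((\<lambda>t. p (t + c)) has_real_derivative max 0 (t + c)) (at t)" for c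
      using p[of "t + c"] by (simp add: DERIV_shift)
    have "((\<lambda>t. p (t + 1) - 2 * p t + p (t + - 1)) has_real_derivative
        max 0 (t + 1) - 2 * max 0 t + max 0 (t + - 1)) (at t)"
      by (intro DERIV_add DERIV_diff DERIV_cmult p shift)
    then show ?thesis
      by (simp add: H_def[abs_def] hat_second_difference)
  qed
  let ?c = "tri_height m n"
  have deriv: "((\<lambda>x. ?c / n * H (real n * x - real m)) has_real_derivative
      ?c * hat (real n * x - real m)) (at x)" for x
  proof -
    have "((\<lambda>x. H (real n * x - real m)) has_real_derivative hat (real n * x - real m) * real n) (at x)"
      by (rule DERIV_chain2[OF H]) (auto intro!: derivative_eq_intros)
    from DERIV_cmult[OF this, of "?c / n"] show ?thesis
      using assms by (simp add: field_simps)
  qed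
  have "(\<integral>\<^sup>+x. ennreal (?c * hat (real n * x - real m)) \<partial>unit_lborel)
      = (\<integral>\<^sup>+x. ennreal (?c * hat (real n * x - real m)) * indicator {0..1} x \<partial>lborel)"
    by (rule nn_integral_restrict_space) simp
  also have "\<dots> = ennreal (?c / n * H (real n * 1 - real m) - ?c / n * H (real n * 0 - real m))"
  proof (rule nn_integral_FTC_Icc)
    show "(\<lambda>x. ?c * hat (real n * x - real m)) \<in> borel_measurable borel"
      unfolding hat_def by measurable
    show "((\<lambda>x. ?c / n * H (real n * x - real m)) has_real_derivative
        ?c * hat (real n * x - real m)) (at x)" for x
      by (rule deriv)
    show "0 \<le> ?c * hat (real n * x - real m)" for x
      by (simp add: hat_def tri_height_def)
  qed simp
  also have "?c / n * H (real n * 1 - real m) - ?c / n * H (real n * 0 - real m) = 1"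
  proof -
    have 1: "H (real n - real m) = (if m = n then 1 / 2 else 1)"
    proof (cases "m = n")
      case False
      then have "1 \<le> real n - real m" using assms by linarith
      then show ?thesis
        using False by (simp add: H_def p_def power2_eq_square field_simps)
    qed (simp add: H_def p_def)
    have 0: "H (- real m) = (if m = 0 then 1 / 2 else 0)"
      by (cases m) (auto simp: H_def p_def)
    show ?thesis
      using assms by (auto simp: 0 1 tri_height_def field_simps)
  qed
  finally show ?thesis by simp
qed

text \<open>At its peak \<open>m / n\<close> the kernel has the value 0, because its defining intervals are open.\<close>
lemma tri_kernel_eq_hat:
  assumes "1 \<le> n" "m \<le> n" "0 \<le> x" "x \<le> 1"
  shows "tri_kernel x m n =
    (if real n * x = real m then 0 else tri_height m n * hat (real n * x - real m))"
proof -
  define y where "y = real n * x"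
  have n: "0 < real n" using assms by simp
  have y: "0 \<le> y" "y \<le> real n"
    using assms n by (auto simp: y_def mult_left_le)
  have less: "x < c / real n \<longleftrightarrow> y < c" "c / real n < x \<longleftrightarrow> c < y" for c
    using n by (auto simp: y_def field_simps)
  have ends: "0 < x \<longleftrightarrow> 0 < y" "x < 1 \<longleftrightarrow> y < real n" "1 - 1 / real n < x \<longleftrightarrow> real n - 1 < y"
    using n less(1)[of "real n"] less(2)[of 0] less(2)[of "real n - 1"] by (auto simp: diff_divide_distrib)
  have vals: "2 * real n - 2 * (real n)\<^sup>2 * x = 2 * real n * (1 - y)"
    "2 * real n + 2 * (real n)\<^sup>2 * (x - 1) = 2 * real n * (1 + (y - real n))"
    "(real n)\<^sup>2 * (x - real m / real n) + real n = real n * (1 + (y - real m))"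
    "- (real n)\<^sup>2 * (x - real m / real n) + real n = real n * (1 - (y - real m))"
    using n by (simp_all add: y_def power2_eq_square field_simps)
  have m: "m = 0 \<or> 1 \<le> real m" "m = n \<or> real m + 1 \<le> real n"
    using \<open>m \<le> n\<close> by linarith+
  show ?thesis
    unfolding tri_kernel_def less ends vals y_def[symmetric]
    using y n m by (auto simp: tri_height_def hat_def max_def abs_if)
qed

lemma AE_not_grid_point:
  assumes "1 \<le> n"
  shows "AE x in unit_lborel. \<forall>m::nat. real n * x \<noteq> real m"
proof -
  have "range (\<lambda>m. real m / real n) \<in> null_sets lborel"
    by (intro countable_imp_null_set_lborel) simp
  then have "AE x in lborel. x \<notin> range (\<lambda>m. real m / real n)"
    by (rule AE_not_in)
  then have "AE x in lborel. x \<in> {0..1} \<longrightarrow> (\<forall>m::nat. real n * x \<noteq> real m)"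
  proof eventually_elim
    case (elim x)
    have "x = real m / real n" if "real n * x = real m" for m
      using that assms by (simp add: field_simps)
    then show ?case using elim by blast
  qed
  then show ?thesis
    by (subst AE_restrict_space_iff) auto
qed

lemma tri_kernel_in_densities:
  assumes "1 \<le> n" "m \<le> n"
  shows "(\<lambda>x. tri_kernel x m n) \<in> densities"
proof -
  have "(\<lambda>x. tri_kernel x m n) \<in> borel_measurable lborel"
    unfolding tri_kernel_def by measurable
  then have "(\<lambda>x. tri_kernel x m n) \<in> borel_measurable unit_lborel"
    by (rule measurable_restrict_space1)
  moreover have "0 \<le> tri_kernel x m n" if "x \<in> {0..1}" for x
    using that assms by (simp add: tri_kernel_eq_hat tri_height_def hat_def)
  moreover have "(\<integral>\<^sup>+x. ennreal (tri_kernel x m n) \<partial>unit_lborel)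
      = (\<integral>\<^sup>+x. ennreal (tri_height m n * hat (real n * x - real m)) \<partial>unit_lborel)"
    using AE_not_grid_point[OF assms(1)] AE_space
    by (intro nn_integral_cong_AE, eventually_elim)
       (use assms in \<open>simp add: tri_kernel_eq_hat space_restrict_space\<close>)
  ultimately show ?thesis
    using assms by (simp add: densities_def nn_integral_hat)
qed

interpretation tri: countable_density_family "\<lambda>x (m, n). tri_kernel x m n" tri_params
proof
  show "countable tri_params" by simp
  show "(\<lambda>x. case a of (m, n) \<Rightarrow> tri_kernel x m n) \<in> densities" if "a \<in> tri_params" for a
    using that by (cases a) (simp add: tri_params_def tri_kernel_in_densities)
qed

section \<open>Approximation of a continuous density\<close>

text \<open>The interpolant at \<open>x\<close> is a weighted mean of the values at grid points closer to \<open>x\<close>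
  than \<open>1 / n\<close>.\<close>
lemma hat_interpolation_bounds:
  fixes f :: "real \<Rightarrow> real"
  assumes n: "1 \<le> n" and x: "0 \<le> x" "x \<le> 1"
    and near: "\<And>m. m \<le> n \<Longrightarrow> \<bar>x - real m / real n\<bar> < 1 / real n \<Longrightarrow> \<bar>f x - f (real m / real n)\<bar> \<le> \<eta>"
  shows "\<bar>f x - (\<Sum>m\<le>n. f (real m / real n) * hat (real n * x - real m))\<bar> \<le> \<eta>"
proof -
  let ?h = "\<lambda>m. hat (real n * x - real m)"
  have one: "(\<Sum>m\<le>n. ?h m) = 1"
    using assms by (intro sum_hat_eq_1) (auto simp: mult_left_le)
  have "f x - (\<Sum>m\<le>n. f (real m / real n) * ?h m) = (\<Sum>m\<le>n. (f x - f (real m / real n)) * ?h m)"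
    using one by (simp add: left_diff_distrib sum_subtractf flip: sum_distrib_left)
  also have "\<bar>\<dots>\<bar> \<le> (\<Sum>m\<le>n. \<bar>(f x - f (real m / real n)) * ?h m\<bar>)"
    by (rule sum_abs)
  also have "\<dots> \<le> (\<Sum>m\<le>n. \<eta> * ?h m)"
  proof (rule sum_mono)
    fix m assume "m \<in> {..n}"
    show "\<bar>(f x - f (real m / real n)) * ?h m\<bar> \<le> \<eta> * ?h m"
    proof (cases "\<bar>real n * x - real m\<bar> < 1")
      case True
      have "\<bar>x - real m / real n\<bar> = \<bar>real n * x - real m\<bar> / real n"
        using n by (simp add: abs_if field_simps)
      with True have "\<bar>x - real m / real n\<bar> < 1 / real n"
        using n by (simp add: divide_strict_right_mono)
      then have "\<bar>f x - f (real m / real n)\<bar> \<le> \<eta>"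
        using near \<open>m \<in> {..n}\<close> by simp
      then show ?thesis
        by (simp add: abs_mult hat_def mult_right_mono)
    qed (simp add: hat_def)
  qed
  also have "\<dots> = \<eta>"
    using one by (simp flip: sum_distrib_left)
  finally show ?thesis .
qed

text \<open>The weights make \<open>C\<close> times the mixture equal, off the grid, to the interpolant of \<open>f + \<eta>\<close>. It lies above \<open>f\<close> because the
  shift by \<open>\<eta>\<close> absorbs the interpolation error, and its integral exceeds 1 by at most \<open>2 * \<eta>\<close>.\<close>
lemma finite_mixture_of_tri_kernels_dominates:
  assumes cont: "continuous_on {0..1} f" and f: "f \<in> densities" and "1 < C"
  shows "\<exists>A v. finite A \<and> A \<subseteq> tri_params \<and> A \<noteq> {} \<and> (\<forall>a\<in>A. 0 \<le> v a) \<and> (\<Sum>a\<in>A. v a) < 1 \<and>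
    (AE x in unit_lborel. f x \<le> C * (\<Sum>a\<in>A. v a * (case a of (m, n) \<Rightarrow> tri_kernel x m n)))"
proof -
  \<comment> \<open>The third \<open>\<eta>\<close> in \<open>C\<close> makes the total weight strictly less than 1.\<close>
  define \<eta> where "\<eta> = (C - 1) / 3"
  have \<eta>: "0 < \<eta>" "C = 1 + 3 * \<eta>" using \<open>1 < C\<close> by (simp_all add: \<eta>_def field_simps)
  have "uniformly_continuous_on {0..1} f"
    using cont by (intro compact_uniformly_continuous) auto
  then obtain d where "0 < d" and d: "\<And>x y. x \<in> {0..1} \<Longrightarrow> y \<in> {0..1} \<Longrightarrow> \<bar>x - y\<bar> < d \<Longrightarrow> \<bar>f x - f y\<bar> < \<eta>"
    using \<eta>(1) unfolding uniformly_continuous_on_def dist_real_def by metis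
  obtain k where "inverse (real (Suc k)) < d"
    using reals_Archimedean[OF \<open>0 < d\<close>] by blast
  then obtain n :: nat where n: "1 \<le> n" "1 / real n < d"
    by (intro that[of "Suc k"]) (auto simp: inverse_eq_divide)
  define A where "A = (\<lambda>m. (m, n)) ` {..n}"
  define v where "v a = (f (real (fst a) / real n) + \<eta>) / (C * tri_height (fst a) n)" for a :: "nat \<times> nat"
  let ?mix = "\<lambda>x. \<Sum>a\<in>A. v a * (case a of (m, n) \<Rightarrow> tri_kernel x m n)"
  have A: "finite A" "A \<subseteq> tri_params" "A \<noteq> {}"
    using n by (auto simp: A_def tri_params_def)
  have f_nonneg: "0 \<le> f (real m / real n)" if "m \<le> n" for m
    using f that n by (auto simp: densities_def)
  have v: "0 \<le> v a" if "a \<in> A" for a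
  proof -
    have "0 \<le> f (real (fst a) / real n)"
      using that by (intro f_nonneg) (auto simp: A_def)
    then show ?thesis
      using \<eta>(1) \<open>1 < C\<close> by (simp add: v_def tri_height_def)
  qed
  have mix: "AE x in unit_lborel. f x \<le> C * ?mix x \<and> C * ?mix x \<le> f x + 2 * \<eta>"
    using AE_not_grid_point[OF n(1)] AE_space
  proof eventually_elim
    case (elim x)
    then have x: "0 \<le> x" "x \<le> 1" by (auto simp: space_restrict_space)
    let ?h = "\<lambda>m. hat (real n * x - real m)"
    have "C * ?mix x = (\<Sum>m\<le>n. C * (v (m, n) * tri_kernel x m n))"
      by (simp add: A_def sum.reindex inj_on_def sum_distrib_left)
    also have "\<dots> = (\<Sum>m\<le>n. f (real m / real n) * ?h m + \<eta> * ?h m)"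
      using elim x n \<open>1 < C\<close>
      by (intro sum.cong) (auto simp: v_def tri_kernel_eq_hat tri_height_def field_simps)
    also have "\<dots> = (\<Sum>m\<le>n. f (real m / real n) * ?h m) + \<eta>"
      using x n by (simp add: sum.distrib sum_hat_eq_1 mult_left_le flip: sum_distrib_left)
    finally have "C * ?mix x = (\<Sum>m\<le>n. f (real m / real n) * ?h m) + \<eta>" .
    moreover have "\<bar>f x - (\<Sum>m\<le>n. f (real m / real n) * ?h m)\<bar> \<le> \<eta>"
    proof (rule hat_interpolation_bounds[OF n(1) x])
      fix m assume "m \<le> n" "\<bar>x - real m / real n\<bar> < 1 / real n"
      then show "\<bar>f x - f (real m / real n)\<bar> \<le> \<eta>"
        using d[of x "real m / real n"] x n by (simp add: less_imp_le)
    qed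
    ultimately show ?case by linarith
  qed
  note int = tri.integral_finite_mixture[OF A(1,2), of v]
  interpret U: prob_space unit_lborel
    by (rule prob_spaceI) (simp add: space_restrict_space emeasure_restrict_space)
  have "C * (\<Sum>a\<in>A. v a) = (\<integral>x. C * ?mix x \<partial>unit_lborel)"
    using int(2) by simp
  also have "\<dots> \<le> (\<integral>x. f x + 2 * \<eta> \<partial>unit_lborel)"
    using mix int(1) densities_integral(1)[OF f] by (intro integral_mono_AE) auto
  also have "\<dots> = 1 + 2 * \<eta>"
    using densities_integral[OF f] U.prob_space by (simp add: space_restrict_space)
  also have "\<dots> < C * 1"
    using \<eta> by simp
  finally have "(\<Sum>a\<in>A. v a) < 1"
    using \<open>1 < C\<close> by (simp only: mult_less_cancel_left_pos)
  moreover have "AE x in unit_lborel. f x \<le> C * ?mix x"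
    using mix by eventually_elim simp
  ultimately show ?thesis
    using A v by (intro exI[of _ A] exI[of _ v]) blast
qed

section \<open>The Kullback-Leibler property of triangular mixtures\<close>

theorem theorem10:
  fixes Prior :: "(nat \<times> nat) measure measure" and f0 :: "real \<Rightarrow> real"
  assumes prior: "prior_on (weak_topology (discrete_topology tri_params)) Prior"
    and f0_continuous: "continuous_on {0..1} f0"
    and f0_density: "f0 \<in> densities"
    and support: "prob_measures (discrete_topology tri_params)
      \<subseteq> support_of (weak_topology (discrete_topology tri_params)) Prior"
  shows "KL_property f0 (kernel_mixture_prior (\<lambda>x (m, n). tri_kernel x m n) Prior)"
  using prior support f0_density finite_mixture_of_tri_kernels_dominates[OF f0_continuous f0_density]
  by (rule tri.KL_property_kernel_mixture_prior)

end
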